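(* If all agents have super-additive valuations, then there exists a mechanism that makes a polynomial number (in $n$ and $m$) of value queries and outputs a combinatorial Walrasian equilibrium (CWE) outcome whose social welfare is within a factor $O(m/\sqrt{\log m})$ of the optimal social welfare.
   Context: $M$ is a finite set of $m$ indivisible items and $[n]$ a set of agents with monotone valuations $v_i:2^M\to\mathbb{R}_{\ge0}$, $v_i(\emptyset)=0$; super-additive means $v(S\cup T)\ge v(S)+v(T)$ for disjoint $S,T$. An allocation is a tuple $(x_0,\dots,x_n)$ of pairwise disjoint sets with union $M$ ($x_0$ unallocated). An allocation with prices $p_k\ge 0$ for each nonempty bundle $x_k$ is a CWE outcome if for every agent $i$ and every set $T$ of indices of nonempty bundles, $u_i\ge v_i(\bigcup_{k\in T}x_k)-\sum_{k\in T}p_k$, where $u_i=v_i(x_i)-p_i$ if $x_i\neq\emptyset$ and $0$ otherwise. A value query asks an agent $i$ for $v_i(S)$ for a given set $S$. Social welfare is $\sum_{i=1}^n v_i(x_i)$. *)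

theory Defs
  imports Complex_Main
begin

text \<open>Items are M = {0..<m}; agents are 1..n; bundle index 0 is the unallocated bundle.
  A valuation profile is v :: nat => nat set => real, with v i the valuation of agent i.\<close>

type_synonym valuations = "nat \<Rightarrow> nat set \<Rightarrow> real"
type_synonym allocation = "nat \<Rightarrow> nat set"
type_synonym prices = "nat \<Rightarrow> real"

definition items :: "nat \<Rightarrow> nat set" where
  "items m = {0..<m}"

definition valuation :: "nat \<Rightarrow> (nat set \<Rightarrow> real) \<Rightarrow> bool" where
  "valuation m w \<longleftrightarrow> w {} = 0 \<and> (\<forall>S \<subseteq> items m. w S \<ge> 0)
     \<and> (\<forall>S T. S \<subseteq> T \<and> T \<subseteq> items m \<longrightarrow> w S \<le> w T)"

definition super_additive :: "nat \<Rightarrow> (nat set \<Rightarrow> real) \<Rightarrow> bool" where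
  "super_additive m w \<longleftrightarrow>
     (\<forall>S T. S \<subseteq> items m \<and> T \<subseteq> items m \<and> S \<inter> T = {} \<longrightarrow> w (S \<union> T) \<ge> w S + w T)"

definition is_allocation :: "nat \<Rightarrow> nat \<Rightarrow> allocation \<Rightarrow> bool" where
  "is_allocation n m x \<longleftrightarrow>
     (\<forall>k\<in>{0..n}. \<forall>l\<in>{0..n}. k \<noteq> l \<longrightarrow> x k \<inter> x l = {}) \<and> (\<Union>k\<in>{0..n}. x k) = items m"

definition utility :: "valuations \<Rightarrow> allocation \<Rightarrow> prices \<Rightarrow> nat \<Rightarrow> real" where
  "utility v x p i = (if x i \<noteq> {} then v i (x i) - p i else 0)"

definition is_CWE :: "nat \<Rightarrow> nat \<Rightarrow> valuations \<Rightarrow> allocation \<Rightarrow> prices \<Rightarrow> bool" where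
  "is_CWE n m v x p \<longleftrightarrow> is_allocation n m x
     \<and> (\<forall>k\<in>{0..n}. x k \<noteq> {} \<longrightarrow> p k \<ge> 0)
     \<and> (\<forall>i\<in>{1..n}. \<forall>T. T \<subseteq> {k\<in>{0..n}. x k \<noteq> {}} \<longrightarrow>
          utility v x p i \<ge> v i (\<Union>k\<in>T. x k) - (\<Sum>k\<in>T. p k))"

definition social_welfare :: "nat \<Rightarrow> valuations \<Rightarrow> allocation \<Rightarrow> real" where
  "social_welfare n v x = (\<Sum>i=1..n. v i (x i))"

text \<open>Deterministic value-query algorithms as decision trees: a node asks agent i for v i S
  and branches on the answer; a leaf outputs an allocation with prices.\<close>

datatype qtree = Output allocation prices | Query nat "nat set" "real \<Rightarrow> qtree"

primrec run :: "valuations \<Rightarrow> qtree \<Rightarrow> allocation \<times> prices" where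
  "run v (Output x p) = (x, p)"
| "run v (Query i S f) = run v (f (v i S))"

primrec num_queries :: "valuations \<Rightarrow> qtree \<Rightarrow> nat" where
  "num_queries v (Output x p) = 0"
| "num_queries v (Query i S f) = Suc (num_queries v (f (v i S)))"

end

theory Submission
  imports Defs "HOL-Library.FuncSet" "HOL-Library.Disjoint_Sets" "HOL-Library.Discrete_Functions"
begin

text \<open>
  Restrict attention to bundles that are unions of blocks of \<open>s \<approx> m / k\<^sup>2\<close> consecutive items,
  where \<open>k \<approx> \<surd>(log m)\<close>. As there are at most \<open>k\<^sup>2 \<le> log m\<close> blocks, every agent can be asked for
  its value of every such bundle with polynomially many queries, and a welfare-maximal allocation of
  block-closed bundles can be computed. Pricing each allocated bundle at its owner's value and the
  unallocated bundle above everybody's value of all items gives a CWE: by optimality and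
  super-additivity no agent gains by buying several bundles.

  For the welfare bound compare with an arbitrary allocation. At most \<open>m / (k + 1)\<close> of its bundles
  have more than \<open>k\<close> items, and each is worth at most the restricted optimum once rounded up to its
  block closure. The block closure of a small bundle meets those of at most \<open>k s\<close> other bundles, so a
  greedy independent set of small bundles retains a \<open>1 / (k s + 1)\<close> fraction of their value. The
  approximation factor is thus \<open>m / (k + 1) + k s + 1 = O(m / k)\<close>.
\<close>

section \<open>Query trees that ask a fixed list of questions\<close>

fun query_list ::
  "(nat \<times> nat set) list \<Rightarrow> valuations \<Rightarrow> (valuations \<Rightarrow> allocation \<times> prices) \<Rightarrow> qtree" where
  "query_list [] w f = Output (fst (f w)) (snd (f w))"
| "query_list ((i, S) # qs) w f = Query i S (\<lambda>r. query_list qs (w(i := (w i)(S := r))) f)"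

lemma num_queries_query_list: "num_queries v (query_list qs w f) = length qs"
  by (induction qs arbitrary: w) auto

lemma run_query_list:
  assumes "\<forall>(i, S) \<in> P. w i S = v i S"
  shows "\<exists>w'. (\<forall>(i, S) \<in> P \<union> set qs. w' i S = v i S) \<and> run v (query_list qs w f) = f w'"
  using assms
proof (induction qs arbitrary: w P)
  case Nil
  then show ?case by auto
next
  case (Cons q qs)
  obtain i S where q: "q = (i, S)"
    by fastforce
  have "\<forall>(j, T) \<in> insert (i, S) P. (w(i := (w i)(S := v i S))) j T = v j T"
    using Cons.prems by auto
  from Cons.IH[OF this] obtain w' where
    "\<forall>(j, T) \<in> insert (i, S) P \<union> set qs. w' j T = v j T"
    "run v (query_list qs (w(i := (w i)(S := v i S))) f) = f w'"
    by blast
  then show ?case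
    unfolding q by auto
qed

section \<open>Welfare maximisation over a union-closed family of bundles\<close>

lemma valuation_empty: "valuation m w \<Longrightarrow> w {} = 0"
  by (simp add: valuation_def)

lemma valuation_nonneg: "valuation m w \<Longrightarrow> S \<subseteq> items m \<Longrightarrow> 0 \<le> w S"
  by (simp add: valuation_def)

lemma valuation_mono: "valuation m w \<Longrightarrow> S \<subseteq> T \<Longrightarrow> T \<subseteq> items m \<Longrightarrow> w S \<le> w T"
  by (simp add: valuation_def)

lemma super_additiveD:
  "super_additive m w \<Longrightarrow> S \<subseteq> items m \<Longrightarrow> T \<subseteq> items m \<Longrightarrow> S \<inter> T = {}
    \<Longrightarrow> w S + w T \<le> w (S \<union> T)"
  by (simp add: super_additive_def)

lemma is_allocation_subset: "is_allocation n m x \<Longrightarrow> k \<in> {0..n} \<Longrightarrow> x k \<subseteq> items m"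
  unfolding is_allocation_def by blast

lemma is_allocation_disjoint:
  "is_allocation n m x \<Longrightarrow> k \<in> {0..n} \<Longrightarrow> l \<in> {0..n} \<Longrightarrow> k \<noteq> l \<Longrightarrow> x k \<inter> x l = {}"
  unfolding is_allocation_def by blast

definition complete_allocation :: "nat \<Rightarrow> nat \<Rightarrow> allocation \<Rightarrow> allocation" where
  "complete_allocation n m B =
     (\<lambda>j. if j = 0 then items m - (\<Union>l\<in>{1..n}. B l) else if j \<le> n then B j else {})"

lemma complete_allocation_agent: "i \<in> {1..n} \<Longrightarrow> complete_allocation n m B i = B i"
  by (simp add: complete_allocation_def)

lemma social_welfare_complete_allocation:
  "social_welfare n v (complete_allocation n m B) = (\<Sum>i=1..n. v i (B i))"
  unfolding social_welfare_def by (intro sum.cong) (auto simp: complete_allocation_agent)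

lemma is_allocation_complete_allocation:
  assumes "\<forall>i\<in>{1..n}. B i \<subseteq> items m" and "disjoint_family_on B {1..n}"
  shows "is_allocation n m (complete_allocation n m B)"
  using assms unfolding is_allocation_def complete_allocation_def disjoint_family_on_def
  by (auto split: if_splits)

locale bundle_family =
  fixes m :: nat and F :: "nat set set"
  assumes subset_items: "S \<in> F \<Longrightarrow> S \<subseteq> items m"
    and empty_mem: "{} \<in> F"
    and items_mem: "items m \<in> F"
    and Un_mem: "A \<in> F \<Longrightarrow> B \<in> F \<Longrightarrow> A \<union> B \<in> F"
begin

lemma UN_mem: "finite T \<Longrightarrow> (\<And>k. k \<in> T \<Longrightarrow> X k \<in> F) \<Longrightarrow> (\<Union>k\<in>T. X k) \<in> F"
  by (induction T rule: finite_induct) (auto intro: empty_mem Un_mem)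

definition feasible :: "nat \<Rightarrow> allocation set" where
  "feasible n = complete_allocation n m ` {B \<in> {1..n} \<rightarrow>\<^sub>E F. disjoint_family_on B {1..n}}"

lemma complete_allocation_feasible:
  assumes "\<forall>i\<in>{1..n}. B i \<in> F" and "disjoint_family_on B {1..n}"
  shows "complete_allocation n m B \<in> feasible n"
proof -
  have "complete_allocation n m B = complete_allocation n m (restrict B {1..n})"
    by (force simp: complete_allocation_def fun_eq_iff)
  moreover have "disjoint_family_on (restrict B {1..n}) {1..n}"
    using assms(2) by (auto simp: disjoint_family_on_def)
  ultimately show ?thesis
    using assms(1) unfolding feasible_def by auto
qed

lemma feasibleE:
  assumes "x \<in> feasible n"
  obtains B where "x = complete_allocation n m B" and "\<forall>i\<in>{1..n}. B i \<in> F"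
    and "disjoint_family_on B {1..n}"
  using assms unfolding feasible_def by auto

lemma feasible_agent_mem: "x \<in> feasible n \<Longrightarrow> i \<in> {1..n} \<Longrightarrow> x i \<in> F"
  by (elim feasibleE) (simp add: complete_allocation_agent)

lemma feasible_is_allocation: "x \<in> feasible n \<Longrightarrow> is_allocation n m x"
  by (elim feasibleE) (simp add: is_allocation_complete_allocation subset_items)

lemma finite_feasible: "finite (feasible n)"
proof -
  have "finite F"
    using subset_items by (intro finite_subset[of F "Pow (items m)"]) (auto simp: items_def)
  then show ?thesis
    unfolding feasible_def
    by (intro finite_imageI finite_subset[OF _ finite_PiE[of "{1..n}" "\<lambda>_. F"]]) auto
qed

definition optimum :: "nat \<Rightarrow> valuations \<Rightarrow> allocation" where
  "optimum n w = arg_max_on (social_welfare n w) (feasible n)"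

lemma optimum_feasible: "optimum n w \<in> feasible n"
  and optimum_maximal: "y \<in> feasible n \<Longrightarrow> social_welfare n w y \<le> social_welfare n w (optimum n w)"
proof -
  have "complete_allocation n m (\<lambda>_. {}) \<in> feasible n"
    by (intro complete_allocation_feasible) (auto simp: empty_mem disjoint_family_on_def)
  then have "Max (social_welfare n w ` feasible n) \<in> social_welfare n w ` feasible n"
    using finite_feasible by (intro Max_in) auto
  then obtain x where x: "x \<in> feasible n" "social_welfare n w x = Max (social_welfare n w ` feasible n)"
    by auto
  then have "is_arg_max (social_welfare n w) (\<lambda>x. x \<in> feasible n) x"
    using finite_feasible by (simp add: is_arg_max_linorder)
  then have "is_arg_max (social_welfare n w) (\<lambda>x. x \<in> feasible n) (optimum n w)"
    unfolding optimum_def arg_max_on_def arg_max_def by (rule someI[of _ x])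
  then show "optimum n w \<in> feasible n"
    and "y \<in> feasible n \<Longrightarrow> social_welfare n w y \<le> social_welfare n w (optimum n w)"
    by (simp_all add: is_arg_max_linorder)
qed

lemma social_welfare_le_optimum:
  assumes "\<forall>i\<in>{1..n}. \<forall>S\<in>F. w i S = v i S" and "y \<in> feasible n"
  shows "social_welfare n v y \<le> social_welfare n v (optimum n w)"
proof -
  have agree: "social_welfare n w z = social_welfare n v z" if "z \<in> feasible n" for z
    unfolding social_welfare_def using assms(1) feasible_agent_mem[OF that] by (intro sum.cong) auto
  show ?thesis
    using optimum_maximal[OF assms(2), of w] agree[OF assms(2)] agree[OF optimum_feasible] by simp
qed

lemma merged_bundle_value_le:
  assumes V: "\<forall>i\<in>{1..n}. valuation m (v i)"
    and x: "x \<in> feasible n" and opt: "\<forall>y\<in>feasible n. social_welfare n v y \<le> social_welfare n v x"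
    and D: "D \<subseteq> {1..n}" "i \<in> D"
  shows "v i (\<Union>k\<in>D. x k) \<le> (\<Sum>k\<in>D. v k (x k))"
proof -
  obtain B where x_eq: "x = complete_allocation n m B"
    and B: "\<forall>j\<in>{1..n}. B j \<in> F" "disjoint_family_on B {1..n}"
    using x by (rule feasibleE)
  have fD: "finite D"
    using D(1) by (rule finite_subset) simp
  define B' where "B' = (\<lambda>j. if j = i then (\<Union>k\<in>D. B k) else if j \<in> D then {} else B j)"
  have "complete_allocation n m B' \<in> feasible n"
  proof (rule complete_allocation_feasible)
    show "\<forall>j\<in>{1..n}. B' j \<in> F"
      using B(1) D fD by (auto simp: B'_def empty_mem intro!: UN_mem)
    have "(\<Union>k\<in>D. B k) \<inter> B j = {}" if "j \<in> {1..n}" "j \<notin> D" for j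
      using B(2) D(1) that by (fastforce dest: disjoint_family_onD)
    then show "disjoint_family_on B' {1..n}"
      using B(2) unfolding B'_def disjoint_family_on_def by (auto simp: Int_commute)
  qed
  then have "social_welfare n v (complete_allocation n m B') \<le> social_welfare n v x"
    using opt by blast
  then have "(\<Sum>j=1..n. v j (B' j)) \<le> (\<Sum>j=1..n. v j (B j))"
    unfolding x_eq social_welfare_complete_allocation .
  moreover have "(\<Sum>j\<in>D. v j (B' j)) = v i (\<Union>k\<in>D. B k)"
  proof -
    have "(\<Sum>j\<in>D. v j (B' j)) = v i (B' i) + (\<Sum>j\<in>D-{i}. v j (B' j))"
      using fD D(2) by (rule sum.remove)
    also have "(\<Sum>j\<in>D-{i}. v j (B' j)) = 0"
      using V D(1) by (intro sum.neutral) (auto simp: B'_def valuation_def)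
    finally show ?thesis
      by (simp add: B'_def)
  qed
  moreover have "(\<Sum>j\<in>{1..n}-D. v j (B' j)) = (\<Sum>j\<in>{1..n}-D. v j (B j))"
    using D(2) by (intro sum.cong) (auto simp: B'_def)
  moreover have "x k = B k" if "k \<in> D" for k
    using D(1) that by (auto simp: x_eq complete_allocation_agent)
  ultimately show ?thesis
    using sum.subset_diff[OF D(1), of "\<lambda>j. v j (B j)"]
      sum.subset_diff[OF D(1), of "\<lambda>j. v j (B' j)"] by simp
qed

lemma bundle_union_value_le:
  assumes V: "\<forall>i\<in>{1..n}. valuation m (v i) \<and> super_additive m (v i)"
    and x: "x \<in> feasible n" and opt: "\<forall>y\<in>feasible n. social_welfare n v y \<le> social_welfare n v x"
    and i: "i \<in> {1..n}" and T: "T \<subseteq> {1..n}"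
  shows "v i (\<Union>k\<in>T. x k) \<le> (\<Sum>k\<in>T. v k (x k))"
proof (cases "i \<in> T")
  case True
  then show ?thesis
    using merged_bundle_value_le[OF _ x opt T True] V by simp
next
  case False
  have alloc: "is_allocation n m x"
    using x by (rule feasible_is_allocation)
  have "(\<Union>k\<in>T. x k) \<inter> x i = {}"
    using is_allocation_disjoint[OF alloc] False T i by fastforce
  moreover have "(\<Union>k\<in>T. x k) \<subseteq> items m" "x i \<subseteq> items m"
    using is_allocation_subset[OF alloc] T i by fastforce+
  ultimately have "v i (\<Union>k\<in>T. x k) + v i (x i) \<le> v i ((\<Union>k\<in>T. x k) \<union> x i)"
    using V i by (intro super_additiveD) auto
  also have "\<dots> = v i (\<Union>k\<in>insert i T. x k)"
    by (simp add: Un_commute)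
  also have "\<dots> \<le> (\<Sum>k\<in>insert i T. v k (x k))"
    by (rule merged_bundle_value_le[OF _ x opt]) (use V T i in auto)
  also have "\<dots> = v i (x i) + (\<Sum>k\<in>T. v k (x k))"
    using False finite_subset[OF T] by simp
  finally show ?thesis
    by simp
qed

text \<open>Every agent pays its value, and the unallocated bundle is priced out of everyone's reach.\<close>

definition prices :: "nat \<Rightarrow> valuations \<Rightarrow> prices" where
  "prices n w = (\<lambda>k. if k = 0 then 1 + (\<Sum>i=1..n. w i (items m)) else w k (optimum n w k))"

lemma optimum_is_CWE:
  assumes V: "\<forall>i\<in>{1..n}. valuation m (v i) \<and> super_additive m (v i)"
    and agree: "\<forall>i\<in>{1..n}. \<forall>S\<in>F. w i S = v i S"
  shows "is_CWE n m v (optimum n w) (prices n w)"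
proof -
  define x where "x = optimum n w"
  define p where "p = prices n w"
  have x: "x \<in> feasible n" and opt: "\<forall>y\<in>feasible n. social_welfare n v y \<le> social_welfare n v x"
    unfolding x_def using optimum_feasible social_welfare_le_optimum[OF agree] by auto
  have alloc: "is_allocation n m x"
    using x by (rule feasible_is_allocation)
  have nonneg: "0 \<le> v i S" if "i \<in> {1..n}" "S \<subseteq> items m" for i S
    using V that by (intro valuation_nonneg) auto
  have p0: "p 0 = 1 + (\<Sum>i=1..n. v i (items m))"
    using agree items_mem by (simp add: p_def prices_def)
  have pk: "p k = v k (x k)" if "k \<in> {1..n}" for k
    using agree feasible_agent_mem[OF x that] that by (simp add: p_def x_def prices_def)
  have p_nonneg: "0 \<le> p k" if "k \<in> {0..n}" for k
  proof (cases "k = 0")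
    case True
    have "0 \<le> (\<Sum>i=1..n. v i (items m))"
      by (intro sum_nonneg nonneg) auto
    then show ?thesis
      using True p0 by simp
  next
    case False
    then show ?thesis
      using pk nonneg is_allocation_subset[OF alloc] that by simp
  qed
  have demand: "v i (\<Union>k\<in>T. x k) \<le> (\<Sum>k\<in>T. p k)"
    if i: "i \<in> {1..n}" and T: "T \<subseteq> {0..n}" for i T
  proof (cases "0 \<in> T")
    case True
    have "(\<Union>k\<in>T. x k) \<subseteq> items m"
      using is_allocation_subset[OF alloc] T by blast
    then have "v i (\<Union>k\<in>T. x k) \<le> v i (items m)"
      using V i by (intro valuation_mono) auto
    also have "\<dots> \<le> (\<Sum>j=1..n. v j (items m))"
      using i nonneg by (intro member_le_sum) auto
    also have "\<dots> \<le> p 0"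
      using p0 by simp
    also have "\<dots> \<le> (\<Sum>k\<in>T. p k)"
      using True T p_nonneg finite_subset[OF T] by (intro member_le_sum) auto
    finally show ?thesis .
  next
    case False
    then have T1: "T \<subseteq> {1..n}"
      using T by (auto simp: subset_iff Suc_le_eq) (metis gr0I)
    then have "(\<Sum>k\<in>T. p k) = (\<Sum>k\<in>T. v k (x k))"
      using pk by (intro sum.cong) auto
    then show ?thesis
      using bundle_union_value_le[OF V x opt i T1] by simp
  qed
  have "utility v x p i = 0" if "i \<in> {1..n}" for i
    using pk[OF that] by (simp add: utility_def)
  then show ?thesis
    using alloc p_nonneg demand unfolding is_CWE_def x_def p_def by (auto simp: subset_iff)
qed

end

section \<open>Block-closed bundles\<close>

definition block_closed :: "nat \<Rightarrow> nat \<Rightarrow> nat set \<Rightarrow> bool" where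
  "block_closed m s S \<longleftrightarrow> S \<subseteq> items m \<and> (\<forall>j\<in>S. \<forall>j'\<in>items m. j' div s = j div s \<longrightarrow> j' \<in> S)"

interpretation block: bundle_family m "Collect (block_closed m s)" for m s
  by unfold_locales (auto simp: block_closed_def)

definition block_closure :: "nat \<Rightarrow> nat \<Rightarrow> nat set \<Rightarrow> nat set" where
  "block_closure m s S = {j \<in> items m. \<exists>j'\<in>S. j' div s = j div s}"

lemma block_closed_block_closure: "block_closed m s (block_closure m s S)"
  by (auto simp: block_closed_def block_closure_def)

lemma subset_block_closure: "S \<subseteq> items m \<Longrightarrow> S \<subseteq> block_closure m s S"
  by (auto simp: block_closure_def)

lemma Int_block_closure_nonempty:
  assumes "block_closure m s A \<inter> block_closure m s B \<noteq> {}" and "B \<subseteq> items m"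
  shows "B \<inter> block_closure m s A \<noteq> {}"
  using assms unfolding block_closure_def by fastforce

lemma card_block_closure_le:
  assumes "finite S" and "0 < s"
  shows "card (block_closure m s S) \<le> card S * s"
proof -
  have "block_closure m s S \<subseteq> (\<lambda>(j', r). j' div s * s + r) ` (S \<times> {..<s})"
  proof
    fix j assume "j \<in> block_closure m s S"
    then obtain j' where "j' \<in> S" "j' div s = j div s"
      by (auto simp: block_closure_def)
    with assms(2) show "j \<in> (\<lambda>(j', r). j' div s * s + r) ` (S \<times> {..<s})"
      by (intro image_eqI[of _ _ "(j', j mod s)"]) auto
  qed
  then have "card (block_closure m s S) \<le> card ((\<lambda>(j', r). j' div s * s + r) ` (S \<times> {..<s}))"
    using assms by (intro card_mono) auto
  also have "\<dots> \<le> card (S \<times> {..<s})"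
    using assms by (intro card_image_le) auto
  finally show ?thesis
    by (simp add: card_cartesian_product)
qed

section \<open>Comparison with an arbitrary allocation\<close>

lemma exists_heavy_independent_subset:
  fixes w :: "'a \<Rightarrow> real" and D :: nat
  assumes "finite A" and "\<forall>a\<in>A. 0 \<le> w a"
    and "\<forall>a\<in>A. card {b\<in>A. b \<noteq> a \<and> R a b} \<le> D" and "\<forall>a b. R a b \<longrightarrow> R b a"
  shows "\<exists>I\<subseteq>A. (\<forall>a\<in>I. \<forall>b\<in>I. a \<noteq> b \<longrightarrow> \<not> R a b) \<and> sum w A \<le> (D + 1) * sum w I"
  using assms
proof (induction "card A" arbitrary: A rule: less_induct)
  case less
  show ?case
  proof (cases "A = {}")
    case True
    then show ?thesis
      by auto
  next
    case False
    \<comment> \<open>Greedy step: keep a heaviest element and discard its at most D neighbours, whose weight it pays for.\<close>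
    have fw: "finite (w ` A)" "w ` A \<noteq> {}"
      using less.prems(1) False by auto
    obtain a where a: "a \<in> A" "w a = Max (w ` A)"
      using Max_in[OF fw] by (metis imageE)
    then have a_max: "\<forall>b\<in>A. w b \<le> w a"
      using Max_ge[OF fw(1)] by auto
    define N where "N = {b\<in>A. b \<noteq> a \<and> R a b}"
    define A' where "A' = A - insert a N"
    have fA': "finite A'"
      using less.prems(1) unfolding A'_def by auto
    have "A' \<subset> A"
      using a(1) unfolding A'_def by auto
    then have cA': "card A' < card A"
      using less.prems(1) by (intro psubset_card_mono)
    have "\<forall>c\<in>A'. card {b\<in>A'. b \<noteq> c \<and> R c b} \<le> D"
    proof
      fix c assume c: "c \<in> A'"
      have "card {b\<in>A'. b \<noteq> c \<and> R c b} \<le> card {b\<in>A. b \<noteq> c \<and> R c b}"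
        using less.prems(1) unfolding A'_def by (intro card_mono) auto
      then show "card {b\<in>A'. b \<noteq> c \<and> R c b} \<le> D"
        using less.prems(3) c unfolding A'_def by fastforce
    qed
    then obtain I' where I': "I' \<subseteq> A'" "\<forall>x\<in>I'. \<forall>y\<in>I'. x \<noteq> y \<longrightarrow> \<not> R x y"
      "sum w A' \<le> (D + 1) * sum w I'"
      using less.hyps[OF cA' fA'] less.prems(2,4) unfolding A'_def by auto
    define I where "I = insert a I'"
    have aI': "a \<notin> I'"
      using I'(1) unfolding A'_def by auto
    have indep: "\<forall>x\<in>I. \<forall>y\<in>I. x \<noteq> y \<longrightarrow> \<not> R x y"
    proof (intro ballI impI)
      fix x y assume "x \<in> I" "y \<in> I" "x \<noteq> y"
      have "\<not> R a b" if "b \<in> I'" for b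
        using that I'(1) aI' unfolding A'_def N_def by auto
      then show "\<not> R x y"
        using \<open>x \<in> I\<close> \<open>y \<in> I\<close> \<open>x \<noteq> y\<close> I'(2) less.prems(4) unfolding I_def by blast
    qed
    have "card (insert a N) \<le> D + 1"
    proof -
      have "finite N"
        using less.prems(1) unfolding N_def by auto
      then have "card (insert a N) \<le> card N + 1"
        by (simp add: card_insert_if)
      moreover have "card N \<le> D"
        using less.prems(3) a(1) unfolding N_def by auto
      ultimately show ?thesis
        by linarith
    qed
    have "sum w A = sum w A' + sum w (insert a N)"
      unfolding A'_def using sum.subset_diff[of "insert a N" A w] less.prems(1) a(1)
      unfolding N_def by auto
    also have "sum w (insert a N) \<le> real (card (insert a N)) * w a"
      using sum_bounded_above[of "insert a N" w "w a"] a(1) a_max unfolding N_def by auto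
    also have "\<dots> \<le> (D + 1) * w a"
      using \<open>card (insert a N) \<le> D + 1\<close> less.prems(2) a(1) by (intro mult_right_mono) auto
    finally have "sum w A \<le> (D + 1) * sum w I' + (D + 1) * w a"
      using I'(3) by linarith
    also have "\<dots> = (D + 1) * sum w I"
      unfolding I_def using aI' I'(1) fA' by (simp add: distrib_left finite_subset)
    finally have "sum w A \<le> (D + 1) * sum w I" .
    moreover have "I \<subseteq> A"
      using I'(1) a(1) unfolding I_def A'_def by blast
    ultimately show ?thesis
      using indep by blast
  qed
qed

context
  fixes n m s :: nat and v :: valuations and y :: allocation and g :: real
  assumes V: "\<forall>i\<in>{1..n}. valuation m (v i)"
    and y: "is_allocation n m y"
    and g: "\<And>z. z \<in> block.feasible m s n \<Longrightarrow> social_welfare n v z \<le> g"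
begin

lemma sum_le_if_disjoint_block_closures:
  assumes I: "I \<subseteq> {1..n}" and disj: "disjoint_family_on (\<lambda>i. block_closure m s (y i)) I"
  shows "(\<Sum>i\<in>I. v i (y i)) \<le> g"
proof -
  define B where "B i = (if i \<in> I then block_closure m s (y i) else {})" for i
  have "complete_allocation n m B \<in> block.feasible m s n"
  proof (rule block.complete_allocation_feasible)
    show "\<forall>i\<in>{1..n}. B i \<in> Collect (block_closed m s)"
      using block_closed_block_closure by (auto simp: B_def block_closed_def)
    show "disjoint_family_on B {1..n}"
      using disj unfolding B_def disjoint_family_on_def by auto
  qed
  then have "social_welfare n v (complete_allocation n m B) \<le> g"
    by (rule g)
  then have "(\<Sum>i=1..n. v i (B i)) \<le> g"
    unfolding social_welfare_complete_allocation .
  have "(\<Sum>i\<in>I. v i (y i)) \<le> (\<Sum>i\<in>I. v i (B i))"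
  proof (rule sum_mono)
    fix i assume i: "i \<in> I"
    then have "y i \<subseteq> items m"
      using I by (intro is_allocation_subset[OF y]) auto
    then show "v i (y i) \<le> v i (B i)"
      using V I i subset_block_closure[of "y i" m s] block_closed_block_closure[of m s "y i"]
      by (intro valuation_mono) (auto simp: B_def block_closed_def)
  qed
  also have "\<dots> = (\<Sum>i=1..n. v i (B i))"
    using I V by (intro sum.mono_neutral_left) (auto simp: B_def valuation_empty)
  finally show ?thesis
    using \<open>(\<Sum>i=1..n. v i (B i)) \<le> g\<close> by simp
qed

lemma block_optimum_nonneg: "0 \<le> g"
  using sum_le_if_disjoint_block_closures[of "{}"] by (simp add: disjoint_family_on_def)

lemma sum_large_bundles_le:
  "(\<Sum>i | i \<in> {1..n} \<and> k < card (y i). v i (y i)) \<le> real (m div (k + 1)) * g"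
proof -
  define L where "L = {i. i \<in> {1..n} \<and> k < card (y i)}"
  have fin: "finite L"
    unfolding L_def by auto
  have "card L * (k + 1) \<le> (\<Sum>i\<in>L. card (y i))"
    using sum_mono[of L "\<lambda>_. k + 1" "\<lambda>i. card (y i)"] unfolding L_def by auto
  also have "\<dots> = card (\<Union>i\<in>L. y i)"
  proof (rule card_UN_disjoint[symmetric])
    show "\<forall>i\<in>L. finite (y i)"
      using is_allocation_subset[OF y] unfolding L_def by (auto simp: items_def intro: finite_subset)
    show "\<forall>i\<in>L. \<forall>j\<in>L. i \<noteq> j \<longrightarrow> y i \<inter> y j = {}"
      unfolding L_def using is_allocation_disjoint[OF y] by auto
  qed (fact fin)
  also have "\<dots> \<le> card (items m)"
    using is_allocation_subset[OF y] unfolding L_def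
    by (intro card_mono) (auto simp: items_def)
  finally have "card L \<le> m div (k + 1)"
    by (simp add: items_def less_eq_div_iff_mult_less_eq)
  have "(\<Sum>i\<in>L. v i (y i)) \<le> (\<Sum>i\<in>L. g)"
    using sum_le_if_disjoint_block_closures[of "{i}" for i] unfolding L_def
    by (intro sum_mono) (simp add: disjoint_family_on_def)
  also have "\<dots> \<le> real (m div (k + 1)) * g"
    using \<open>card L \<le> m div (k + 1)\<close> block_optimum_nonneg by (simp add: mult_right_mono)
  finally show ?thesis
    unfolding L_def .
qed

lemma card_conflicting_agents_le:
  assumes s: "0 < s" and a: "a \<in> {1..n}"
  shows "card {b \<in> {1..n}. b \<noteq> a \<and> block_closure m s (y a) \<inter> block_closure m s (y b) \<noteq> {}}
    \<le> card (y a) * s"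
proof -
  define C where "C = {b \<in> {1..n}. b \<noteq> a \<and> block_closure m s (y a) \<inter> block_closure m s (y b) \<noteq> {}}"
  define f where "f b = (SOME j. j \<in> y b \<inter> block_closure m s (y a))" for b
  have f: "f b \<in> y b \<inter> block_closure m s (y a)" if "b \<in> C" for b
  proof -
    have "block_closure m s (y a) \<inter> block_closure m s (y b) \<noteq> {}"
      using that by (simp add: C_def)
    moreover have "y b \<subseteq> items m"
      using that by (intro is_allocation_subset[OF y]) (simp add: C_def)
    ultimately have "y b \<inter> block_closure m s (y a) \<noteq> {}"
      by (rule Int_block_closure_nonempty)
    then obtain j where "j \<in> y b \<inter> block_closure m s (y a)"
      by blast
    then show ?thesis
      unfolding f_def by (rule someI)
  qed
  have "inj_on f C"
  proof (rule inj_onI)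
    fix b b' assume b: "b \<in> C" "b' \<in> C" "f b = f b'"
    then have "f b \<in> y b \<inter> y b'"
      using f[of b] f[of b'] by simp
    show "b = b'"
    proof (rule ccontr)
      assume "b \<noteq> b'"
      then have "y b \<inter> y b' = {}"
        using b(1,2) by (intro is_allocation_disjoint[OF y]) (simp_all add: C_def)
      with \<open>f b \<in> y b \<inter> y b'\<close> show False
        by blast
    qed
  qed
  moreover have "f ` C \<subseteq> block_closure m s (y a)"
    using f by auto
  moreover have "finite (block_closure m s (y a))"
    by (auto simp: block_closure_def items_def)
  ultimately have "card C \<le> card (block_closure m s (y a))"
    by (rule card_inj_on_le)
  also have "\<dots> \<le> card (y a) * s"
  proof (rule card_block_closure_le[OF _ s])
    show "finite (y a)"
      using is_allocation_subset[OF y, of a] a by (auto simp: items_def intro: finite_subset)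
  qed
  finally show ?thesis
    unfolding C_def .
qed

lemma sum_small_bundles_le:
  assumes s: "0 < s"
  shows "(\<Sum>i | i \<in> {1..n} \<and> card (y i) \<le> k. v i (y i)) \<le> real (k * s + 1) * g"
proof -
  define S where "S = {i. i \<in> {1..n} \<and> card (y i) \<le> k}"
  define R where "R a b \<longleftrightarrow> block_closure m s (y a) \<inter> block_closure m s (y b) \<noteq> {}" for a b
  have "\<forall>a\<in>S. card {b\<in>S. b \<noteq> a \<and> R a b} \<le> k * s"
  proof
    fix a assume a: "a \<in> S"
    have "card {b\<in>S. b \<noteq> a \<and> R a b} \<le> card {b \<in> {1..n}. b \<noteq> a \<and> R a b}"
      by (intro card_mono) (auto simp: S_def)
    also have "\<dots> \<le> card (y a) * s"
      using card_conflicting_agents_le[OF s, of a] a by (simp add: S_def R_def)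
    also have "\<dots> \<le> k * s"
      using a by (simp add: S_def)
    finally show "card {b\<in>S. b \<noteq> a \<and> R a b} \<le> k * s" .
  qed
  moreover have "\<forall>a\<in>S. 0 \<le> v a (y a)"
    using V is_allocation_subset[OF y] by (auto simp: S_def intro!: valuation_nonneg)
  moreover have "finite S" "\<forall>a b. R a b \<longrightarrow> R b a"
    by (auto simp: S_def R_def)
  ultimately obtain I where I: "I \<subseteq> S" "\<forall>a\<in>I. \<forall>b\<in>I. a \<noteq> b \<longrightarrow> \<not> R a b"
    "(\<Sum>a\<in>S. v a (y a)) \<le> real (k * s + 1) * (\<Sum>a\<in>I. v a (y a))"
    using exists_heavy_independent_subset[of S "\<lambda>a. v a (y a)" R "k * s"] by auto
  have "(\<Sum>a\<in>I. v a (y a)) \<le> g"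
    using I(1,2) by (intro sum_le_if_disjoint_block_closures)
      (auto simp: S_def R_def disjoint_family_on_def)
  then have "real (k * s + 1) * (\<Sum>a\<in>I. v a (y a)) \<le> real (k * s + 1) * g"
    by (intro mult_left_mono) auto
  with I(3) show ?thesis
    unfolding S_def by linarith
qed

lemma social_welfare_le_block_optimum:
  assumes "0 < s"
  shows "social_welfare n v y \<le> (real (m div (k + 1)) + real (k * s) + 1) * g"
proof -
  define L where "L = {i. i \<in> {1..n} \<and> k < card (y i)}"
  define S where "S = {i. i \<in> {1..n} \<and> card (y i) \<le> k}"
  have "{1..n} = L \<union> S" "L \<inter> S = {}" "finite L" "finite S"
    by (auto simp: L_def S_def)
  then have "social_welfare n v y = (\<Sum>i\<in>L. v i (y i)) + (\<Sum>i\<in>S. v i (y i))"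
    unfolding social_welfare_def by (simp add: sum.union_disjoint)
  then show ?thesis
    using sum_large_bundles_le[of k] sum_small_bundles_le[OF assms, of k]
    unfolding L_def S_def by (simp add: algebra_simps)
qed

end

section \<open>Choice of the block size\<close>

definition threshold :: "nat \<Rightarrow> nat" where
  "threshold m = floor_sqrt (floor_log m)"

text \<open>As \<open>m div 0 = 0\<close>, the block size is \<open>1\<close> when the threshold vanishes, i.e.\ for \<open>m < 2\<close>.\<close>

definition block_size :: "nat \<Rightarrow> nat" where
  "block_size m = m div (threshold m)\<^sup>2 + 1"

lemma block_size_pos: "0 < block_size m"
  by (simp add: block_size_def)

lemma two_pow_threshold_le: "0 < m \<Longrightarrow> 2 ^ (threshold m)\<^sup>2 \<le> m"
proof -
  assume "0 < m"
  have "(2::nat) ^ (threshold m)\<^sup>2 \<le> 2 ^ floor_log m"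
    unfolding threshold_def by (intro power_increasing) auto
  also have "\<dots> \<le> m"
    using \<open>0 < m\<close> by (rule floor_log_exp2_le)
  finally show ?thesis .
qed

lemma less_two_pow_Suc_threshold: "m < 2 ^ (threshold m + 1)\<^sup>2"
proof -
  have "floor_log m < (threshold m + 1)\<^sup>2"
    unfolding threshold_def using Suc_floor_sqrt_power2_gt by simp
  have "m < 2 * 2 ^ floor_log m"
    by (rule floor_log_exp2_gt)
  also have "\<dots> = 2 ^ Suc (floor_log m)"
    by simp
  also have "\<dots> \<le> 2 ^ (threshold m + 1)\<^sup>2"
    using \<open>floor_log m < (threshold m + 1)\<^sup>2\<close> by (intro power_increasing) auto
  finally show ?thesis .
qed

lemma two_pow_num_blocks_le: "2 ^ (m div block_size m + 1) \<le> 4 * (m + 1)"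
proof (cases "threshold m = 0")
  case True
  then have "m < 2"
    using less_two_pow_Suc_threshold[of m] by simp
  moreover have "block_size m = 1"
    using True by (simp add: block_size_def)
  ultimately show ?thesis
    by (auto simp: less_2_cases_iff)
next
  case False
  define k where "k = threshold m"
  have "m mod k\<^sup>2 < k\<^sup>2"
    using False unfolding k_def by simp
  have "m = m div k\<^sup>2 * k\<^sup>2 + m mod k\<^sup>2"
    by (rule div_mult_mod_eq[symmetric])
  also have "\<dots> < m div k\<^sup>2 * k\<^sup>2 + k\<^sup>2"
    using \<open>m mod k\<^sup>2 < k\<^sup>2\<close> by simp
  also have "\<dots> = block_size m * k\<^sup>2"
    by (simp add: k_def block_size_def algebra_simps)
  finally have "m < block_size m * k\<^sup>2" .
  then have "m div block_size m < k\<^sup>2"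
    by (simp add: div_less_iff_less_mult block_size_def mult.commute)
  then have "m div block_size m + 1 \<le> k\<^sup>2"
    by simp
  then have "(2::nat) ^ (m div block_size m + 1) \<le> 2 ^ k\<^sup>2"
    by (intro power_increasing) auto
  also have "\<dots> \<le> m"
    using False by (intro two_pow_threshold_le[of m, folded k_def]) (auto simp: threshold_def intro!: gr0I)
  finally show ?thesis
    by simp
qed

lemma sqrt_ln_le_threshold:
  assumes "2 \<le> m"
  shows "sqrt (ln (real m + 2)) \<le> 3 * real (threshold m)"
proof -
  define K where "K = real (threshold m)"
  have "threshold m \<noteq> 0"
  proof
    assume "threshold m = 0"
    then have "m < 2"
      using less_two_pow_Suc_threshold[of m] by simp
    with assms show False
      by simp
  qed
  then have K: "1 \<le> K"
    unfolding K_def by simp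
  have "real m < 2 ^ (threshold m + 1)\<^sup>2"
    using less_two_pow_Suc_threshold[of m] by (simp add: of_nat_less_numeral_power_cancel_iff)
  then have "ln (real m) < ln (2 ^ (threshold m + 1)\<^sup>2)"
    using assms by (intro ln_less_cancel_iff[THEN iffD2]) auto
  also have "\<dots> = (K + 1)\<^sup>2 * ln 2"
    unfolding K_def by (simp add: ln_realpow)
  also have "\<dots> \<le> (K + 1)\<^sup>2"
    using ln_2_less_1 by (intro mult_left_le) auto
  finally have ln_m: "ln (real m) < (K + 1)\<^sup>2" .
  have "2 * real m \<le> real m * real m"
    using assms by (intro mult_right_mono) auto
  then have "real m + 2 \<le> real m * real m"
    using assms by linarith
  then have "ln (real m + 2) \<le> ln (real m * real m)"
    by simp
  also have "\<dots> = 2 * ln (real m)"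
    using assms by (simp add: ln_mult)
  also have "\<dots> \<le> (3 * K)\<^sup>2"
  proof -
    have "K \<le> K * K"
      using K mult_left_mono[of 1 K K] by simp
    moreover have "(K + 1)\<^sup>2 = K * K + 2 * K + 1" "(3 * K)\<^sup>2 = 9 * (K * K)"
      by (simp_all add: power2_eq_square algebra_simps)
    ultimately show ?thesis
      using ln_m K by linarith
  qed
  finally have "sqrt (ln (real m + 2)) \<le> sqrt ((3 * K)\<^sup>2)"
    by (rule real_sqrt_le_mono)
  also have "\<dots> = 3 * K"
    using K by (intro real_sqrt_unique) auto
  finally show ?thesis
    unfolding K_def .
qed

lemma approximation_factor_le:
  assumes "0 < m"
  shows "real (m div (threshold m + 1)) + real (threshold m * block_size m) + 1
    \<le> 12 * (real m / sqrt (ln (real m + 2)))"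
proof (cases "threshold m = 0")
  case True
  then have "m = 1"
    using assms less_two_pow_Suc_threshold[of m] by simp
  have "ln (3::real) \<le> 4"
    using ln_le_minus_one[of 3] by simp
  then have "sqrt (ln 3) \<le> (2::real)"
    using real_sqrt_le_mono[of "ln 3" 4] by simp
  then have "2 \<le> 12 / sqrt (ln (3::real))"
    by (simp add: field_simps)
  then show ?thesis
    using True \<open>m = 1\<close> by (simp add: block_size_def)
next
  case False
  define k where "k = threshold m"
  define K where "K = real k"
  have K: "1 \<le> K"
    using False unfolding K_def k_def by simp
  have "k\<^sup>2 < 2 ^ k\<^sup>2"
    by (rule less_exp)
  also have "\<dots> \<le> m"
    unfolding k_def using assms by (rule two_pow_threshold_le)
  finally have K_sq: "K\<^sup>2 \<le> real m"
    unfolding K_def by (metis less_imp_le of_nat_le_iff of_nat_power)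
  have m2: "2 \<le> m"
    using False two_pow_threshold_le[OF assms] power_increasing[of 1 "(threshold m)\<^sup>2" "2::nat"]
    by (simp add: Suc_le_eq)
  have "real (m div (k + 1)) \<le> real m / (K + 1)"
    using of_nat_div_le_of_nat[of m "k + 1", where 'a = real] by (simp add: K_def add.commute)
  also have "\<dots> \<le> real m / K"
    using K by (intro divide_left_mono) auto
  finally have large: "real (m div (k + 1)) \<le> real m / K" .
  have "real (m div k\<^sup>2) \<le> real m / K\<^sup>2"
    using of_nat_div_le_of_nat[of m "k\<^sup>2", where 'a = real] by (simp add: K_def)
  then have "K * real (m div k\<^sup>2) \<le> K * (real m / K\<^sup>2)"
    using K by (intro mult_left_mono) auto
  then have small: "real (k * block_size m) \<le> real m / K + K"
    using K by (simp add: block_size_def k_def[symmetric] K_def[symmetric] power2_eq_square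
        algebra_simps)
  have "K \<le> K * K"
    using K mult_left_mono[of 1 K K] by simp
  then have "K * (K + 1) \<le> 2 * real m"
    using K_sq by (simp add: power2_eq_square algebra_simps)
  then have rest: "K + 1 \<le> 2 * real m / K"
    using K by (simp add: field_simps)
  have "sqrt (ln (real m + 2)) \<le> 3 * K"
    unfolding K_def k_def using m2 by (rule sqrt_ln_le_threshold)
  moreover have "0 < sqrt (ln (real m + 2))"
    by simp
  ultimately have "real m / (3 * K) \<le> real m / sqrt (ln (real m + 2))"
    using K by (intro divide_left_mono) (auto intro: mult_pos_pos)
  have "real (m div (k + 1)) + real (k * block_size m) + 1 \<le> 4 * real m / K"
  proof -
    have "4 * real m / K = real m / K + real m / K + 2 * real m / K"
      by (simp add: field_simps)
    then show ?thesis
      using large small rest by linarith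
  qed
  also have "\<dots> = 12 * (real m / (3 * K))"
    by simp
  also have "\<dots> \<le> 12 * (real m / sqrt (ln (real m + 2)))"
    using \<open>real m / (3 * K) \<le> _\<close> by simp
  finally show ?thesis
    unfolding k_def .
qed

section \<open>The mechanism\<close>

definition block_union :: "nat \<Rightarrow> nat \<Rightarrow> nat set \<Rightarrow> nat set" where
  "block_union m s R = {j \<in> items m. j div s \<in> R}"

lemma block_closed_imp_block_union:
  assumes "block_closed m s S"
  shows "\<exists>R \<subseteq> {..<m div s + 1}. S = block_union m s R"
proof (intro exI conjI)
  show "(\<lambda>j. j div s) ` S \<subseteq> {..<m div s + 1}"
    using assms by (auto simp: block_closed_def items_def less_Suc_eq_le div_le_mono)
  show "S = block_union m s ((\<lambda>j. j div s) ` S)"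
    using assms by (auto simp: block_union_def block_closed_def)
qed

definition block_queries :: "nat \<Rightarrow> nat \<Rightarrow> nat \<Rightarrow> (nat \<times> nat set) list" where
  "block_queries n m s =
     [(i, block_union m s (set R)). i \<leftarrow> [1..<n + 1], R \<leftarrow> subseqs [0..<m div s + 1]]"

lemma length_block_queries: "length (block_queries n m s) = n * 2 ^ (m div s + 1)"
  by (induction n) (simp_all add: block_queries_def length_subseqs)

lemma block_closed_mem_block_queries:
  assumes "i \<in> {1..n}" and "block_closed m s S"
  shows "(i, S) \<in> set (block_queries n m s)"
proof -
  obtain R where R: "R \<subseteq> {..<m div s + 1}" "S = block_union m s R"
    using block_closed_imp_block_union[OF assms(2)] by blast
  then have "R \<in> set ` set (subseqs [0..<m div s + 1])"
    by (intro subset_subseqs) auto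
  then obtain r where "r \<in> set (subseqs [0..<m div s + 1])" "R = set r"
    by blast
  then show ?thesis
    using assms(1) R(2) unfolding block_queries_def set_concat set_map
    by (auto simp del: upt_Suc)
qed

definition mechanism :: "nat \<Rightarrow> nat \<Rightarrow> qtree" where
  "mechanism n m = query_list (block_queries n m (block_size m)) (\<lambda>_ _. 0)
     (\<lambda>w. (block.optimum m (block_size m) n w, block.prices m (block_size m) n w))"

lemma num_queries_mechanism: "real (num_queries v (mechanism n m)) \<le> 4 * (real n + real m + 1)\<^sup>2"
proof -
  have "num_queries v (mechanism n m) = n * 2 ^ (m div block_size m + 1)"
    by (simp add: mechanism_def num_queries_query_list length_block_queries)
  also have "\<dots> \<le> n * (4 * (m + 1))"
    by (intro mult_left_mono two_pow_num_blocks_le) auto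
  also have "\<dots> \<le> 4 * (n + m + 1)\<^sup>2"
    by (simp add: power2_eq_square algebra_simps)
  finally have "real (num_queries v (mechanism n m)) \<le> real (4 * (n + m + 1)\<^sup>2)"
    by (simp only: of_nat_le_iff)
  then show ?thesis
    by (simp add: add.commute)
qed

lemma run_mechanism:
  obtains w where "\<forall>i\<in>{1..n}. \<forall>S\<in>Collect (block_closed m (block_size m)). w i S = v i S"
    and "run v (mechanism n m) = (block.optimum m (block_size m) n w, block.prices m (block_size m) n w)"
proof -
  have "\<exists>w. (\<forall>(i, S) \<in> {} \<union> set (block_queries n m (block_size m)). w i S = v i S)
    \<and> run v (mechanism n m) = (block.optimum m (block_size m) n w, block.prices m (block_size m) n w)"
    unfolding mechanism_def by (rule run_query_list) simp
  then obtain w where queried: "\<forall>(i, S) \<in> set (block_queries n m (block_size m)). w i S = v i S"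
    and "run v (mechanism n m) = (block.optimum m (block_size m) n w, block.prices m (block_size m) n w)"
    by auto
  moreover have "\<forall>i\<in>{1..n}. \<forall>S\<in>Collect (block_closed m (block_size m)). w i S = v i S"
  proof (intro ballI)
    fix i S assume "i \<in> {1..n}" "S \<in> Collect (block_closed m (block_size m))"
    then have "(i, S) \<in> set (block_queries n m (block_size m))"
      by (intro block_closed_mem_block_queries) auto
    with queried show "w i S = v i S"
      by fast
  qed
  ultimately show ?thesis
    using that by blast
qed

lemma mechanism_is_CWE:
  assumes "\<forall>i\<in>{1..n}. valuation m (v i) \<and> super_additive m (v i)"
  shows "is_CWE n m v (fst (run v (mechanism n m))) (snd (run v (mechanism n m)))"
proof -
  obtain w where agree: "\<forall>i\<in>{1..n}. \<forall>S\<in>Collect (block_closed m (block_size m)). w i S = v i S"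
    and run: "run v (mechanism n m)
      = (block.optimum m (block_size m) n w, block.prices m (block_size m) n w)"
    by (rule run_mechanism)
  show ?thesis
    unfolding run using block.optimum_is_CWE[OF assms agree] by simp
qed

lemma mechanism_welfare:
  assumes V: "\<forall>i\<in>{1..n}. valuation m (v i)" and y: "is_allocation n m y"
  shows "social_welfare n v y
    \<le> 12 * (real m / sqrt (ln (real m + 2))) * social_welfare n v (fst (run v (mechanism n m)))"
proof (cases "m = 0")
  case True
  have "social_welfare n v y = 0"
    unfolding social_welfare_def
  proof (intro sum.neutral ballI)
    fix i assume i: "i \<in> {1..n}"
    then have "y i = {}"
      using is_allocation_subset[OF y, of i] True by (auto simp: items_def)
    moreover have "valuation m (v i)"
      using V i by simp
    ultimately show "v i (y i) = 0"
      by (simp add: valuation_empty)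
  qed
  then show ?thesis
    using True by simp
next
  case False
  obtain w where agree: "\<forall>i\<in>{1..n}. \<forall>S\<in>Collect (block_closed m (block_size m)). w i S = v i S"
    and run: "run v (mechanism n m) = (block.optimum m (block_size m) n w, block.prices m (block_size m) n w)"
    by (rule run_mechanism)
  define g where "g = social_welfare n v (block.optimum m (block_size m) n w)"
  have opt: "\<And>z. z \<in> block.feasible m (block_size m) n \<Longrightarrow> social_welfare n v z \<le> g"
    unfolding g_def using agree by (rule block.social_welfare_le_optimum)
  have "social_welfare n v y \<le> (real (m div (threshold m + 1)) + real (threshold m * block_size m) + 1) * g"
    using V y opt block_size_pos by (rule social_welfare_le_block_optimum)
  also have "\<dots> \<le> 12 * (real m / sqrt (ln (real m + 2))) * g"
    using False approximation_factor_le block_optimum_nonneg[OF V y opt]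
    by (intro mult_right_mono) auto
  finally show ?thesis
    unfolding run g_def by simp
qed

theorem theorem3:
  shows "\<exists>(A :: nat \<Rightarrow> nat \<Rightarrow> qtree) (c::real) (d::nat) (C::real). C > 0 \<and>
    (\<forall>n m (v :: valuations).
       (\<forall>i\<in>{1..n}. valuation m (v i) \<and> super_additive m (v i)) \<longrightarrow>
       real (num_queries v (A n m)) \<le> c * (real n + real m + 1) ^ d \<and>
       is_CWE n m v (fst (run v (A n m))) (snd (run v (A n m))) \<and>
       (\<forall>y. is_allocation n m y \<longrightarrow>
          social_welfare n v y \<le>
            C * (real m / sqrt (ln (real m + 2))) * social_welfare n v (fst (run v (A n m)))))"
proof -
  have "real (num_queries v (mechanism n m)) \<le> 4 * (real n + real m + 1) ^ 2
    \<and> is_CWE n m v (fst (run v (mechanism n m))) (snd (run v (mechanism n m)))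
    \<and> (\<forall>y. is_allocation n m y \<longrightarrow> social_welfare n v y
          \<le> 12 * (real m / sqrt (ln (real m + 2))) * social_welfare n v (fst (run v (mechanism n m))))"
    if V: "\<forall>i\<in>{1..n}. valuation m (v i) \<and> super_additive m (v i)" for n m v
    using num_queries_mechanism mechanism_is_CWE[OF V] mechanism_welfare V by auto
  then show ?thesis
    by (intro exI[of _ mechanism] exI[of _ "4::real"] exI[of _ "2::nat"] exI[of _ "12::real"]) simp
qed

end
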